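(* Let $\nu>0$, $\tau>0$, let $c,k$ be as in the context, and let $\sigma$ satisfy $\nu c_0\sigma\ge 0.5$. Let $u^n\in H$ ($n=0,\dots,N$) and $q_\alpha^{n+1/2}\in H_\alpha$ ($\alpha=1,2$, $n=0,\dots,N-1$) satisfy the additive scheme $$\bigl(k^{-1}E+\sigma\tau^2A_\alpha A_\alpha^*\bigr)\frac{q_\alpha^{n+1/2}+q_\alpha^{n-1/2}}{2}+\nu\bigl(k^{-1}E+\sigma\tau^2A_\alpha A_\alpha^*\bigr)\frac{q_\alpha^{n+1/2}-q_\alpha^{n-1/2}}{\tau}+A_\alpha u^n=0,\quad \alpha=1,2,\ n=1,\dots,N-1,$$ $$c\,\frac{u^{n+1}-u^n}{\tau}-\sum_{\alpha=1}^2A_\alpha^*q_\alpha^{n+1/2}=f^{n+1/2},\qquad n=0,1,\dots,N-1,$$ with given $f^{n+1/2}\in H$. Define on $H$ $$C=\sum_{\alpha=1}^2A_\alpha^*\bigl(k^{-1}E+\sigma\tau^2A_\alpha A_\alpha^*\bigr)^{-1}A_\alpha,\qquad R=\nu cE-\frac{\tau^2}{4}C,$$ and for $n=1,\dots,N$ put $$S^n=\Bigl(R\,\frac{u^n-u^{n-1}}{\tau},\frac{u^n-u^{n-1}}{\tau}\Bigr)+\Bigl(C\,\frac{u^n+u^{n-1}}{2},\frac{u^n+u^{n-1}}{2}\Bigr).$$ Then the scheme is unconditionally stable: with no restriction on $\tau,h_1,h_2$, one has $R>0$ and $S^n$ is the square of a norm of the pair $(u^n,u^{n-1})$ (a positive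 definite quadratic form on $H\times H$), and $$S^{n+1}\le S^n+\frac{\tau}{2}\,(c^{-1}\varphi^n,\varphi^n),\qquad n=1,\dots,N-1,$$ where $\varphi^n=\dfrac{f^{n+1/2}+f^{n-1/2}}{2}+\nu\,\dfrac{f^{n+1/2}-f^{n-1/2}}{\tau}$.
   Context: Let $\Omega=(0,l_1)\times(0,l_2)$, let $c,k$ be real functions on $\Omega$ with $c(\mathbf{x})\ge c_0>0$ and $k_0\le k(\mathbf{x})\le k_1$, $k_0>0$, and let $\nu>0$ be a constant. Let $h_\alpha=l_\alpha/N_\alpha$ ($N_\alpha\ge2$ integers, $\alpha=1,2$). Grids: $\omega$ is the set of points $(i_1h_1,i_2h_2)$ with $1\le i_\alpha\le N_\alpha-1$; $\omega_1$ is the set of points $((i_1+\tfrac12)h_1,i_2h_2)$ with $0\le i_1\le N_1-1$, $1\le i_2\le N_2-1$; $\omega_2$ is the set of points $(i_1h_1,(i_2+\tfrac12)h_2)$ with $1\le i_1\le N_1-1$, $0\le i_2\le N_2-1$. $H$ is the space of real functions on the points $(i_1h_1,i_2h_2)$, $0\le i_\alpha\le N_\alpha$, vanishing at the points on $\partial\Omega$, with scalar product $(y,w)=\sum_{\mathbf{x}\in\omega}y(\mathbf{x})w(\mathbf{x})h_1h_2$. $H_\alpha$ is the space of real functions on $\omega_\alpha$ with $(y,w)_\alpha=\sum_{\mathbf{x}\in\omega_\alpha}y(\mathbf{x})w(\mathbf{x})h_1h_2$. The operators $A_\alpha:H\to H_\alpha$ are $(A_1y)(\mathbf{x})=\frac{y(x_1+0.5h_1,x_2)-y(x_1-0.5h_1,x_2)}{h_1}$,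 $\mathbf{x}\in\omega_1$, and $(A_2y)(\mathbf{x})=\frac{y(x_1,x_2+0.5h_2)-y(x_1,x_2-0.5h_2)}{h_2}$, $\mathbf{x}\in\omega_2$; $A_\alpha^*:H_\alpha\to H$ are their adjoints. Here $c$ and $k$ also denote the multiplication operators by the values of $c$ at points of $\omega$ and of $k$ at points of $\omega_\alpha$ (so $k^{-1}E$ acts on $H_\alpha$); $E$ is the identity; $R>0$ means $R$ is positive definite. Time grid: $t_n=n\tau$, $n=0,\dots,N$, $N\tau=T$, $N\ge 2$; superscripts $n$ and $n+1/2$ denote values at $t_n$ and $t_n+\tau/2$. *)

theory Defs
  imports "HOL-Analysis.Analysis"
begin

type_synonym point = "real \<times> real"
type_synonym gridfun = "point \<Rightarrow> real"

record mesh =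
  l1 :: real
  l2 :: real
  N1 :: nat
  N2 :: nat

definition h1 :: "mesh \<Rightarrow> real" where "h1 M = l1 M / real (N1 M)"
definition h2 :: "mesh \<Rightarrow> real" where "h2 M = l2 M / real (N2 M)"

definition Omega :: "mesh \<Rightarrow> point set" where
  "Omega M = {0<..<l1 M} \<times> {0<..<l2 M}"

definition omega_bar :: "mesh \<Rightarrow> point set" where
  "omega_bar M = {(real i1 * h1 M, real i2 * h2 M) | i1 i2. i1 \<le> N1 M \<and> i2 \<le> N2 M}"

definition omega :: "mesh \<Rightarrow> point set" where
  "omega M = {(real i1 * h1 M, real i2 * h2 M) | i1 i2.
                1 \<le> i1 \<and> i1 \<le> N1 M - 1 \<and> 1 \<le> i2 \<and> i2 \<le> N2 M - 1}"

text \<open>The staggered grids and the difference operators carry the direction \<open>\<alpha>\<close> as an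
  argument; only \<open>\<alpha> = 1\<close> and \<open>\<alpha> = 2\<close> are used.\<close>

definition omega_half :: "mesh \<Rightarrow> nat \<Rightarrow> point set" where
  "omega_half M \<alpha> =
     (if \<alpha> = 1
      then {((real i1 + 1/2) * h1 M, real i2 * h2 M) | i1 i2.
              i1 \<le> N1 M - 1 \<and> 1 \<le> i2 \<and> i2 \<le> N2 M - 1}
      else {(real i1 * h1 M, (real i2 + 1/2) * h2 M) | i1 i2.
              1 \<le> i1 \<and> i1 \<le> N1 M - 1 \<and> i2 \<le> N2 M - 1})"

text \<open>A function on a finite grid is represented by its extension by zero to the whole plane, so
  that equality of grid functions is equality in HOL.\<close>

definition H :: "mesh \<Rightarrow> gridfun set" where
  "H M = {y. (\<forall>x. x \<notin> omega_bar M \<longrightarrow> y x = 0) \<and>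
             (\<forall>x \<in> omega_bar M \<inter> frontier (Omega M). y x = 0)}"

definition H_half :: "mesh \<Rightarrow> nat \<Rightarrow> gridfun set" where
  "H_half M \<alpha> = {q. \<forall>x. x \<notin> omega_half M \<alpha> \<longrightarrow> q x = 0}"

definition ip :: "mesh \<Rightarrow> gridfun \<Rightarrow> gridfun \<Rightarrow> real" where
  "ip M y w = (\<Sum>x\<in>omega M. y x * w x * h1 M * h2 M)"

definition ip_half :: "mesh \<Rightarrow> nat \<Rightarrow> gridfun \<Rightarrow> gridfun \<Rightarrow> real" where
  "ip_half M \<alpha> y w = (\<Sum>x\<in>omega_half M \<alpha>. y x * w x * h1 M * h2 M)"

definition A :: "mesh \<Rightarrow> nat \<Rightarrow> gridfun \<Rightarrow> gridfun" where
  "A M \<alpha> y = (\<lambda>(x1, x2).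
     if (x1, x2) \<notin> omega_half M \<alpha> then 0
     else if \<alpha> = 1 then (y (x1 + 0.5 * h1 M, x2) - y (x1 - 0.5 * h1 M, x2)) / h1 M
     else (y (x1, x2 + 0.5 * h2 M) - y (x1, x2 - 0.5 * h2 M)) / h2 M)"

text \<open>The library constant \<^const>\<open>adjoint\<close> lives on inner product types, not on carrier sets, so
  the adjoint is described here as the element of \<open>H\<close> given by its defining identity.\<close>

definition A_adj :: "mesh \<Rightarrow> nat \<Rightarrow> gridfun \<Rightarrow> gridfun" where
  "A_adj M \<alpha> q = (THE w. w \<in> H M \<and> (\<forall>y \<in> H M. ip_half M \<alpha> (A M \<alpha> y) q = ip M y w))"

text \<open>\<open>K\<close> is the operator \<open>k\<^sup>-\<^sup>1E + \<sigma>\<tau>\<^sup>2A\<^sub>\<alpha>A\<^sub>\<alpha>\<^sup>*\<close>; its inverse is taken on \<open>H\<^sub>\<alpha>\<close>.\<close>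

definition K :: "mesh \<Rightarrow> (point \<Rightarrow> real) \<Rightarrow> real \<Rightarrow> real \<Rightarrow> nat \<Rightarrow> gridfun \<Rightarrow> gridfun" where
  "K M k \<sigma> \<tau> \<alpha> q = (\<lambda>x. inverse (k x) * q x + \<sigma> * \<tau>^2 * A M \<alpha> (A_adj M \<alpha> q) x)"

definition C :: "mesh \<Rightarrow> (point \<Rightarrow> real) \<Rightarrow> real \<Rightarrow> real \<Rightarrow> gridfun \<Rightarrow> gridfun" where
  "C M k \<sigma> \<tau> y =
     (\<lambda>x. \<Sum>\<alpha>\<in>{1,2}. A_adj M \<alpha> (inv_into (H_half M \<alpha>) (K M k \<sigma> \<tau> \<alpha>) (A M \<alpha> y)) x)"

definition R :: "mesh \<Rightarrow> (point \<Rightarrow> real) \<Rightarrow> (point \<Rightarrow> real) \<Rightarrow> real \<Rightarrow> real \<Rightarrow> real \<Rightarrow> gridfun \<Rightarrow> gridfun" where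
  "R M c k \<nu> \<sigma> \<tau> y = (\<lambda>x. \<nu> * c x * y x - \<tau>^2 / 4 * C M k \<sigma> \<tau> y x)"

text \<open>The form whose value at the pair \<open>(u\<^sup>n, u\<^sup>n\<^sup>-\<^sup>1)\<close> is \<open>S\<^sup>n\<close>.\<close>

definition S_form :: "mesh \<Rightarrow> (point \<Rightarrow> real) \<Rightarrow> (point \<Rightarrow> real) \<Rightarrow> real \<Rightarrow> real \<Rightarrow> real \<Rightarrow>
    gridfun \<Rightarrow> gridfun \<Rightarrow> real" where
  "S_form M c k \<nu> \<sigma> \<tau> v w =
     ip M (R M c k \<nu> \<sigma> \<tau> (\<lambda>x. (v x - w x) / \<tau>)) (\<lambda>x. (v x - w x) / \<tau>)
     + ip M (C M k \<sigma> \<tau> (\<lambda>x. (v x + w x) / 2)) (\<lambda>x. (v x + w x) / 2)"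

text \<open>The argument \<open>f\<close> at \<open>n\<close> stands for \<open>f\<close> at the half-integer level \<open>n + 1/2\<close>.\<close>

definition phi :: "real \<Rightarrow> real \<Rightarrow> (nat \<Rightarrow> gridfun) \<Rightarrow> nat \<Rightarrow> gridfun" where
  "phi \<nu> \<tau> f n = (\<lambda>x. (f n x + f (n - 1) x) / 2 + \<nu> * ((f n x - f (n - 1) x) / \<tau>))"

text \<open>On a real space positivity of \<open>(Ry, y)\<close> does not entail symmetry; as usual for positive
  definite operators, self-adjointness is part of the notion.\<close>

definition pos_def_operator :: "mesh \<Rightarrow> (gridfun \<Rightarrow> gridfun) \<Rightarrow> bool" where
  "pos_def_operator M B \<longleftrightarrow>
     B \<in> H M \<rightarrow> H M \<and>
     (\<forall>y \<in> H M. \<forall>w \<in> H M. ip M (B y) w = ip M y (B w)) \<and>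
     (\<forall>y \<in> H M. y \<noteq> (\<lambda>_. 0) \<longrightarrow> 0 < ip M (B y) y)"

text \<open>Quadratic forms and norms on \<open>V \<times> V\<close> take the two components as separate arguments.\<close>

definition pos_def_quadratic_form_pairs ::
  "gridfun set \<Rightarrow> (gridfun \<Rightarrow> gridfun \<Rightarrow> real) \<Rightarrow> bool" where
  "pos_def_quadratic_form_pairs V Q \<longleftrightarrow>
     (\<exists>B :: gridfun \<times> gridfun \<Rightarrow> gridfun \<times> gridfun \<Rightarrow> real.
        (\<forall>z \<in> V \<times> V. \<forall>z' \<in> V \<times> V. B z z' = B z' z) \<and>
        (\<forall>a b. \<forall>v\<in>V. \<forall>w\<in>V. \<forall>v'\<in>V. \<forall>w'\<in>V. \<forall>z \<in> V \<times> V.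
           B (\<lambda>x. a * v x + b * v' x, \<lambda>x. a * w x + b * w' x) z
             = a * B (v, w) z + b * B (v', w') z) \<and>
        (\<forall>v\<in>V. \<forall>w\<in>V. Q v w = B (v, w) (v, w))) \<and>
     (\<forall>v\<in>V. \<forall>w\<in>V. (v, w) \<noteq> (\<lambda>_. 0, \<lambda>_. 0) \<longrightarrow> 0 < Q v w)"

definition norm_on_pairs :: "gridfun set \<Rightarrow> (gridfun \<Rightarrow> gridfun \<Rightarrow> real) \<Rightarrow> bool" where
  "norm_on_pairs V p \<longleftrightarrow>
     (\<forall>v\<in>V. \<forall>w\<in>V. 0 \<le> p v w \<and> (p v w = 0 \<longleftrightarrow> v = (\<lambda>_. 0) \<and> w = (\<lambda>_. 0))) \<and>
     (\<forall>a. \<forall>v\<in>V. \<forall>w\<in>V. p (\<lambda>x. a * v x) (\<lambda>x. a * w x) = \<bar>a\<bar> * p v w) \<and>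
     (\<forall>v\<in>V. \<forall>w\<in>V. \<forall>v'\<in>V. \<forall>w'\<in>V.
        p (\<lambda>x. v x + v' x) (\<lambda>x. w x + w' x) \<le> p v w + p v' w')"

end

theory Submission
  imports Defs "HOL-Library.Function_Algebras"
begin

text \<open>Eliminating the fluxes \<open>q\<^sub>\<alpha>\<close> turns the scheme into the three-level equation
  \<open>\<nu>c(u\<^sup>n\<^sup>+\<^sup>1 - 2u\<^sup>n + u\<^sup>n\<^sup>-\<^sup>1)/\<tau>\<^sup>2 + c(u\<^sup>n\<^sup>+\<^sup>1 - u\<^sup>n\<^sup>-\<^sup>1)/(2\<tau>) + Cu\<^sup>n = \<phi>\<^sup>n\<close>. Since \<open>S\<^sup>n\<close> equals
  \<open>(\<nu>c(u\<^sup>n - u\<^sup>n\<^sup>-\<^sup>1), u\<^sup>n - u\<^sup>n\<^sup>-\<^sup>1)/\<tau>\<^sup>2 + (Cu\<^sup>n, u\<^sup>n\<^sup>-\<^sup>1)\<close> by symmetry of \<open>C\<close>, testing with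
  \<open>u\<^sup>n\<^sup>+\<^sup>1 - u\<^sup>n\<^sup>-\<^sup>1\<close> telescopes, and the damping term absorbs the right-hand side by Young's inequality.
  Positivity of \<open>R\<close> comes from \<open>\<sigma>\<tau>\<^sup>2(Cy, y) < 2(y, y)\<close>, one \<open>(y, y)\<close> for each direction.\<close>

section \<open>Linear maps on finitely supported functions\<close>

text \<open>An injective linear map sends a basis to an independent set of the same size, which must
  span again in finite dimension. The carrier is a set of functions, not a type, so dimension theory
  is applied to a subspace of all functions. This is what makes the operator \<open>K\<close>
  invertible.\<close>

lemma linear_inj_imp_surj_on_support:
  fixes L :: "('a \<Rightarrow> real) \<Rightarrow> 'a \<Rightarrow> real"
  defines "V X \<equiv> {f :: 'a \<Rightarrow> real. \<forall>x. x \<notin> X \<longrightarrow> f x = 0}"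
  assumes fin: "finite X"
    and maps: "\<And>f. f \<in> V X \<Longrightarrow> L f \<in> V X"
    and lin: "\<And>a b f g. L (\<lambda>x. a * f x + b * g x) = (\<lambda>x. a * L f x + b * L g x)"
    and inj: "inj_on L (V X)"
  shows "L ` V X = V X"
proof -
  define s :: "real \<Rightarrow> ('a \<Rightarrow> real) \<Rightarrow> 'a \<Rightarrow> real" where "s = (\<lambda>a f x. a * f x)"
  interpret vector_space s
    by unfold_locales (auto simp: s_def fun_eq_iff algebra_simps)
  have L_add: "L (f + g) = L f + L g" for f g
    using lin[of 1 f 1 g] by (simp add: plus_fun_def)
  have L_scale: "L (s a f) = s a (L f)" for a f
    using lin[of a f 0 f] by (simp add: s_def)
  interpret L: Vector_Spaces.linear s s L
    by unfold_locales (simp_all add: L_add L_scale)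
  have sub: "subspace (V X)"
    by (rule subspaceI) (auto simp: V_def s_def)
  \<comment> \<open>Point indicators span \<open>V X\<close>; they bound the size of every
    independent subset and so make the basis \<open>B\<close> finite.\<close>
  define \<delta> :: "'a \<Rightarrow> 'a \<Rightarrow> real" where "\<delta> = (\<lambda>z x. of_bool (x = z))"
  have V_span: "V X \<subseteq> span (\<delta> ` X)"
  proof
    fix f assume "f \<in> V X"
    have "f = (\<Sum>z\<in>X. s (f z) (\<delta> z))"
    proof
      fix x
      have sum_app: "(\<Sum>z\<in>Y. g z) x = (\<Sum>z\<in>Y. g z x)" for Y and g :: "'a \<Rightarrow> 'a \<Rightarrow> real"
        by (induction Y rule: infinite_finite_induct) auto
      have "f x = (\<Sum>z\<in>X. if x = z then f z else 0)"
        using \<open>f \<in> V X\<close> fin by (auto simp: V_def)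
      also have "\<dots> = (\<Sum>z\<in>X. s (f z) (\<delta> z)) x"
        by (auto simp: sum_app s_def \<delta>_def intro!: sum.cong)
      finally show "f x = (\<Sum>z\<in>X. s (f z) (\<delta> z)) x" .
    qed
    also have "\<dots> \<in> span (\<delta> ` X)"
      by (intro span_sum span_scale span_base imageI)
    finally show "f \<in> span (\<delta> ` X)" .
  qed
  obtain B where B: "B \<subseteq> V X" "independent B" "V X \<subseteq> span B"
    using maximal_independent_subset by blast
  have finB: "finite B"
    using independent_span_bound[of "\<delta> ` X" B] fin B V_span by auto
  have spanB: "span B = V X"
    using B sub by (simp add: span_subspace)
  have indL: "independent (L ` B)"
    using L.independent_injective_image[OF B(2)] inj spanB by simp
  have cardL: "card (L ` B) = card B"
    using card_image inj_on_subset[OF inj B(1)] by blast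
  have LB: "L ` B \<subseteq> V X"
    using maps B(1) by blast
  have "V X \<subseteq> span (L ` B)"
  \<comment> \<open>A vector missed by the span would give \<open>card B + 1\<close> independent
    vectors inside \<open>span B\<close>.\<close>
  proof (rule ccontr)
    assume "\<not> V X \<subseteq> span (L ` B)"
    then obtain v where v: "v \<in> V X" "v \<notin> span (L ` B)"
      by blast
    then have "independent (insert v (L ` B))"
      using indL by (simp add: independent_insertI)
    then have "card (insert v (L ` B)) \<le> card B"
      using independent_span_bound[OF finB] v LB B(3) by blast
    moreover have "v \<notin> L ` B"
      using v span_base by blast
    ultimately show False
      using finB cardL by simp
  qed
  also have "span (L ` B) = L ` V X"
    using L.span_image[of B] spanB by simp
  finally show ?thesis
    using maps by blast
qed

section \<open>Grid functions and the adjoint difference operators\<close>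

locale grid =
  fixes M :: mesh
  assumes l1: "l1 M > 0" and l2: "l2 M > 0" and N1: "N1 M \<ge> 2" and N2: "N2 M \<ge> 2"
begin

lemma h1_pos: "h1 M > 0" and h2_pos: "h2 M > 0"
  using l1 l2 N1 N2 by (auto simp: h1_def h2_def)

lemma N_h1: "real (N1 M) * h1 M = l1 M" and N_h2: "real (N2 M) * h2 M = l2 M"
  using N1 N2 by (auto simp: h1_def h2_def)

lemma less_l1: "r < real (N1 M) \<Longrightarrow> r * h1 M < l1 M"
  using mult_strict_right_mono[OF _ h1_pos] N_h1 by metis

lemma less_l2: "r < real (N2 M) \<Longrightarrow> r * h2 M < l2 M"
  using mult_strict_right_mono[OF _ h2_pos] N_h2 by metis

lemma omega_subset_Omega: "omega M \<subseteq> Omega M"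
  using N1 N2 h1_pos h2_pos
  by (auto simp: omega_def Omega_def intro!: less_l1 less_l2)

lemma omega_half_subset_Omega: "omega_half M \<alpha> \<subseteq> Omega M"
  using N1 N2 h1_pos h2_pos
  by (auto simp: omega_half_def Omega_def split: if_splits
      intro!: less_l1 less_l2 mult_pos_pos add_nonneg_pos)

lemma finite_omega: "finite (omega M)"
proof -
  have "omega M \<subseteq> (\<lambda>(i, j). (real i * h1 M, real j * h2 M)) ` ({..N1 M} \<times> {..N2 M})"
    by (force simp: omega_def)
  then show ?thesis
    by (rule finite_subset) simp
qed

lemma finite_omega_half: "finite (omega_half M \<alpha>)"
proof -
  have "omega_half M \<alpha> \<subseteq>
      (\<lambda>(i, j). ((real i + 1/2) * h1 M, real j * h2 M)) ` ({..N1 M} \<times> {..N2 M})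
      \<union> (\<lambda>(i, j). (real i * h1 M, (real j + 1/2) * h2 M)) ` ({..N1 M} \<times> {..N2 M})"
    unfolding omega_half_def by (cases "\<alpha> = 1") force+
  then show ?thesis
    by (rule finite_subset) simp
qed

lemma frontier_Omega: "frontier (Omega M) = {0..l1 M} \<times> {0..l2 M} - Omega M"
proof -
  have "open (Omega M)"
    by (simp add: Omega_def open_Times)
  then show ?thesis
    using l1 l2 by (simp add: frontier_def interior_open Omega_def closure_Times)
qed

lemma omega_eq: "omega M = omega_bar M - frontier (Omega M)"
proof (intro equalityI subsetI)
  fix x assume x: "x \<in> omega M"
  then have "x \<in> omega_bar M"
    by (force simp: omega_def omega_bar_def)
  then show "x \<in> omega_bar M - frontier (Omega M)"
    using x omega_subset_Omega by (auto simp: frontier_Omega)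
next
  fix x assume x: "x \<in> omega_bar M - frontier (Omega M)"
  then obtain i j where ij: "x = (real i * h1 M, real j * h2 M)" "i \<le> N1 M" "j \<le> N2 M"
    by (auto simp: omega_bar_def)
  have "real i * h1 M \<le> l1 M" "real j * h2 M \<le> l2 M"
    using mult_right_mono[of "real i" "real (N1 M)" "h1 M"]
      mult_right_mono[of "real j" "real (N2 M)" "h2 M"] ij h1_pos h2_pos N_h1 N_h2 by auto
  then have "x \<in> {0..l1 M} \<times> {0..l2 M}"
    using ij h1_pos h2_pos by auto
  then have "x \<in> Omega M"
    using x frontier_Omega by blast
  then have x': "0 < real i * h1 M" "real i * h1 M < l1 M" "0 < real j * h2 M" "real j * h2 M < l2 M"
    using ij by (auto simp: Omega_def)
  then have "i \<noteq> 0" "j \<noteq> 0" "i \<noteq> N1 M" "j \<noteq> N2 M"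
    using N_h1 N_h2 by (auto intro: ccontr)
  then have "1 \<le> i" "i \<le> N1 M - 1" "1 \<le> j" "j \<le> N2 M - 1"
    using ij by auto
  then show "x \<in> omega M"
    unfolding omega_def ij(1) by blast
qed

text \<open>Zero boundary values and extension by zero merge into one condition: support in the
  finite set of interior nodes.\<close>

lemma H_eq: "H M = {y. \<forall>x. x \<notin> omega M \<longrightarrow> y x = 0}"
  by (auto simp: H_def omega_eq)

lemma H_lincomb: "y \<in> H M \<Longrightarrow> w \<in> H M \<Longrightarrow> (\<lambda>x. a * y x + b * w x) \<in> H M"
  by (auto simp: H_eq)

lemma H_half_lincomb:
  "p \<in> H_half M \<alpha> \<Longrightarrow> q \<in> H_half M \<alpha> \<Longrightarrow> (\<lambda>x. a * p x + b * q x) \<in> H_half M \<alpha>"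
  by (auto simp: H_half_def)

lemma ip_commute: "ip M y w = ip M w y"
  by (simp add: ip_def mult.commute mult.left_commute)

lemma ip_lincomb_left: "ip M (\<lambda>x. a * y x + b * w x) z = a * ip M y z + b * ip M w z"
  by (simp add: ip_def algebra_simps sum.distrib sum_distrib_left)

lemma ip_lincomb_right: "ip M z (\<lambda>x. a * y x + b * w x) = a * ip M z y + b * ip M z w"
  by (simp add: ip_def algebra_simps sum.distrib sum_distrib_left)

lemma ip_half_lincomb_left:
  "ip_half M \<alpha> (\<lambda>x. a * p x + b * q x) r = a * ip_half M \<alpha> p r + b * ip_half M \<alpha> q r"
  by (simp add: ip_half_def algebra_simps sum.distrib sum_distrib_left)

lemma ip_half_lincomb_right:
  "ip_half M \<alpha> r (\<lambda>x. a * p x + b * q x) = a * ip_half M \<alpha> r p + b * ip_half M \<alpha> r q"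
  by (simp add: ip_half_def algebra_simps sum.distrib sum_distrib_left)

lemma ip_weighted_pos:
  assumes "\<And>x. x \<in> omega M \<Longrightarrow> g x > 0" "y \<in> H M" "y \<noteq> (\<lambda>_. 0)"
  shows "0 < ip M (\<lambda>x. g x * y x) y"
proof -
  obtain z where z: "z \<in> omega M" "y z \<noteq> 0"
    using assms(2,3) unfolding H_eq fun_eq_iff by blast
  have nonneg: "0 \<le> g x * y x * y x * h1 M * h2 M" if "x \<in> omega M" for x
    using assms(1)[OF that] h1_pos h2_pos by (auto simp: mult.assoc zero_le_mult_iff mult_le_0_iff)
  have pos: "0 < g z * y z * y z * h1 M * h2 M"
    using assms(1)[OF z(1)] z(2) h1_pos h2_pos by (auto simp: mult.assoc zero_less_mult_iff mult_less_0_iff)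
  show ?thesis
    unfolding ip_def by (rule sum_pos2[OF finite_omega z(1)]) (fact pos nonneg)+
qed

lemma ip_self_nonneg: "0 \<le> ip M y y"
  unfolding ip_def using h1_pos h2_pos by (intro sum_nonneg) simp

lemma ip_half_weighted_pos:
  assumes "\<And>x. x \<in> omega_half M \<alpha> \<Longrightarrow> g x > 0" "p \<in> H_half M \<alpha>" "p \<noteq> (\<lambda>_. 0)"
  shows "0 < ip_half M \<alpha> (\<lambda>x. g x * p x) p"
proof -
  obtain z where z: "z \<in> omega_half M \<alpha>" "p z \<noteq> 0"
    using assms(2,3) unfolding H_half_def fun_eq_iff by blast
  have nonneg: "0 \<le> g x * p x * p x * h1 M * h2 M" if "x \<in> omega_half M \<alpha>" for x
    using assms(1)[OF that] h1_pos h2_pos by (auto simp: mult.assoc zero_le_mult_iff mult_le_0_iff)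
  have pos: "0 < g z * p z * p z * h1 M * h2 M"
    using assms(1)[OF z(1)] z(2) h1_pos h2_pos by (auto simp: mult.assoc zero_less_mult_iff mult_less_0_iff)
  show ?thesis
    unfolding ip_half_def by (rule sum_pos2[OF finite_omega_half z(1)]) (fact pos nonneg)+
qed

lemma A_in_H_half: "A M \<alpha> y \<in> H_half M \<alpha>"
  by (auto simp: A_def H_half_def)

lemma A_lincomb: "A M \<alpha> (\<lambda>x. a * y x + b * w x) = (\<lambda>x. a * A M \<alpha> y x + b * A M \<alpha> w x)"
  by (auto simp: A_def fun_eq_iff diff_divide_distrib add_divide_distrib algebra_simps)

lemma A_sum: "A M \<alpha> (\<lambda>x. \<Sum>z\<in>Z. g z x) = (\<lambda>x. \<Sum>z\<in>Z. A M \<alpha> (g z) x)"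
  by (auto simp: A_def fun_eq_iff simp flip: sum_subtractf sum_divide_distrib)

text \<open>Along each grid row the vanishing difference carries the zero value at the left boundary
  from node to node. One direction is enough, and the definiteness of \<open>C\<close> rests on
  it.\<close>

lemma A_eq_0_imp:
  assumes y: "y \<in> H M" and A0: "A M 1 y = (\<lambda>_. 0)"
  shows "y = (\<lambda>_. 0)"
proof
  fix x
  show "y x = 0"
  proof (cases "x \<in> omega M")
    case True
    then obtain i j where ij: "x = (real i * h1 M, real j * h2 M)" "i \<le> N1 M - 1"
      "1 \<le> j" "j \<le> N2 M - 1"
      by (auto simp: omega_def)
    have "i \<le> N1 M - 1 \<Longrightarrow> y (real i * h1 M, real j * h2 M) = 0" for i
    proof (induction i)
      case 0
      have "(0, real j * h2 M) \<notin> omega M"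
        using omega_subset_Omega by (auto simp: Omega_def)
      then show ?case
        using y by (simp add: H_eq)
    next
      case (Suc i)
      let ?x = "((real i + 1/2) * h1 M, real j * h2 M)"
      have "?x \<in> omega_half M 1"
        unfolding omega_half_def using Suc.prems ij by (simp, metis One_nat_def Suc_leD)
      then have "y ((real i + 1/2) * h1 M + 0.5 * h1 M, real j * h2 M)
          - y ((real i + 1/2) * h1 M - 0.5 * h1 M, real j * h2 M) = 0"
        using fun_cong[OF A0, of ?x] h1_pos by (simp add: A_def)
      moreover have "(real i + 1/2) * h1 M + 0.5 * h1 M = real (Suc i) * h1 M"
        "(real i + 1/2) * h1 M - 0.5 * h1 M = real i * h1 M"
        by (simp_all add: algebra_simps)
      ultimately show ?case
        using Suc by simp
    qed
    then show ?thesis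
      using ij by simp
  next
    case False
    then show ?thesis
      using y unfolding H_eq by blast
  qed
qed

text \<open>Justifies the definite description in \<open>A_adj\<close>. Testing the defining
  identity with the indicator of \<open>z\<close> forces the value at \<open>z\<close>, up to the
  cell area \<open>h1 M * h2 M\<close>; definiteness of the scalar product gives uniqueness.\<close>

lemma A_adj_eq:
  "A_adj M \<alpha> q = (\<lambda>z. if z \<in> omega M
     then ip_half M \<alpha> (A M \<alpha> (\<lambda>x. of_bool (x = z))) q / (h1 M * h2 M) else 0)"
    (is "_ = ?w")
  and ip_A_adj: "y \<in> H M \<Longrightarrow> ip M y (A_adj M \<alpha> q) = ip_half M \<alpha> (A M \<alpha> y) q"
proof -
  have w: "ip_half M \<alpha> (A M \<alpha> y) q = ip M y ?w" if y: "y \<in> H M" for y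
  proof -
    have "y = (\<lambda>x. \<Sum>z\<in>omega M. y z * of_bool (x = z))"
    proof
      fix x
      have "(\<Sum>z\<in>omega M. y z * of_bool (x = z)) = (\<Sum>z\<in>omega M. if x = z then y z else 0)"
        by (intro sum.cong) auto
      moreover have "x \<notin> omega M \<Longrightarrow> y x = 0"
        using y unfolding H_eq by blast
      ultimately show "y x = (\<Sum>z\<in>omega M. y z * of_bool (x = z))"
        using finite_omega by simp
    qed
    then have "A M \<alpha> y = A M \<alpha> (\<lambda>x. \<Sum>z\<in>omega M. y z * of_bool (x = z))"
      by (rule arg_cong)
    also have "\<dots> = (\<lambda>x. \<Sum>z\<in>omega M. y z * A M \<alpha> (\<lambda>x. of_bool (x = z)) x)"
      unfolding A_sum using A_lincomb[of \<alpha> "y z" "\<lambda>x. of_bool (x = z)" 0 "\<lambda>_. 0" for z] by simp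
    finally have "ip_half M \<alpha> (A M \<alpha> y) q
        = (\<Sum>z\<in>omega M. y z * ip_half M \<alpha> (A M \<alpha> (\<lambda>x. of_bool (x = z))) q)"
      by (simp add: ip_half_def sum_distrib_left sum_distrib_right mult.assoc
          sum.swap[of _ "omega M"])
    also have "\<dots> = ip M y ?w"
      using h1_pos h2_pos by (auto simp: ip_def intro!: sum.cong)
    finally show ?thesis .
  qed
  show eq: "A_adj M \<alpha> q = ?w"
    unfolding A_adj_def
  proof (rule the_equality)
    show "?w \<in> H M \<and> (\<forall>y\<in>H M. ip_half M \<alpha> (A M \<alpha> y) q = ip M y ?w)"
      using w by (simp add: H_eq)
  next
    fix v assume v: "v \<in> H M \<and> (\<forall>y\<in>H M. ip_half M \<alpha> (A M \<alpha> y) q = ip M y v)"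
    \<comment> \<open>Both candidates represent the same functional, so their difference is
      orthogonal to itself. The explicit coefficients match the linear-combination lemmas.\<close>
    define d where "d = (\<lambda>x. 1 * v x + (-1) * ?w x)"
    have d: "d \<in> H M"
      unfolding d_def using v by (intro H_lincomb) (auto simp: H_eq)
    have "ip M d v = ip M d ?w"
      by (rule trans[OF sym[OF bspec[OF conjunct2[OF v] d]] w[OF d]])
    moreover have "ip M d d = 1 * ip M d v + (-1) * ip M d ?w"
      by (subst (2) d_def) (rule ip_lincomb_right)
    ultimately have "ip M d d = 0"
      by linarith
    then have "d = (\<lambda>_. 0)"
      using ip_weighted_pos[of "\<lambda>_. 1", OF _ d] by auto
    then have diff_0: "1 * v x + (-1) * ?w x = 0" for x
      unfolding d_def by (rule fun_cong)
    have "a = b" if "1 * a + (-1) * b = 0" for a b :: real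
      using that by simp
    from this[OF diff_0] show "v = ?w"
      by (rule ext)
  qed
  show "y \<in> H M \<Longrightarrow> ip M y (A_adj M \<alpha> q) = ip_half M \<alpha> (A M \<alpha> y) q"
    by (simp add: eq w)
qed

lemma A_adj_in_H: "A_adj M \<alpha> q \<in> H M"
  by (simp add: A_adj_eq H_eq)

lemma A_adj_lincomb:
  "A_adj M \<alpha> (\<lambda>x. a * p x + b * q x) = (\<lambda>x. a * A_adj M \<alpha> p x + b * A_adj M \<alpha> q x)"
  by (auto simp: A_adj_eq ip_half_lincomb_right add_divide_distrib fun_eq_iff)

end

section \<open>The operators of the scheme\<close>

locale additive_scheme = grid +
  fixes c k :: "point \<Rightarrow> real" and \<nu> \<sigma> \<tau> c0 :: real
  assumes nu: "\<nu> > 0" and tau: "\<tau> > 0" and c0: "c0 > 0"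
    and c_ge: "\<And>x. x \<in> Omega M \<Longrightarrow> c x \<ge> c0"
    and k_pos: "\<And>x. x \<in> Omega M \<Longrightarrow> k x > 0"
    and sigma: "\<nu> * c0 * \<sigma> \<ge> 1 / 2"
begin

abbreviation "KK \<equiv> K M k \<sigma> \<tau>"
abbreviation "CC \<equiv> C M k \<sigma> \<tau>"
abbreviation "RR \<equiv> R M c k \<nu> \<sigma> \<tau>"
abbreviation "SS \<equiv> S_form M c k \<nu> \<sigma> \<tau>"
text \<open>This is \<open>K\<^sup>-\<^sup>1A\<^sub>\<alpha>y\<close>, so that \<open>C\<close> is
  the sum of the operators \<open>A\<^sub>\<alpha>\<^sup>*P\<close>.\<close>

abbreviation "P \<alpha> y \<equiv> inv_into (H_half M \<alpha>) (KK \<alpha>) (A M \<alpha> y)"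

lemma sigma_pos: "\<sigma> > 0"
proof (rule ccontr)
  assume "\<not> \<sigma> > 0"
  then have "\<nu> * c0 * \<sigma> \<le> 0"
    using nu c0 by (intro mult_nonneg_nonpos) auto
  then show False
    using sigma by simp
qed

lemma c_pos: "x \<in> omega M \<Longrightarrow> c x > 0"
  by (meson c_ge c0 omega_subset_Omega less_le_trans subsetD)

section \<open>The operator \<open>K\<close> and its inverse on the staggered grids\<close>

lemma K_in_H_half: "p \<in> H_half M \<alpha> \<Longrightarrow> KK \<alpha> p \<in> H_half M \<alpha>"
  using A_in_H_half by (auto simp: K_def H_half_def)

lemma K_lincomb: "KK \<alpha> (\<lambda>x. a * p x + b * q x) = (\<lambda>x. a * KK \<alpha> p x + b * KK \<alpha> q x)"
  unfolding K_def A_adj_lincomb A_lincomb by (simp add: algebra_simps)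

text \<open>Moving the outer difference operator across the scalar product leaves a form that is
  visibly symmetric and positive.\<close>

lemma ip_K: "ip_half M \<alpha> (KK \<alpha> p) q
    = ip_half M \<alpha> (\<lambda>x. inverse (k x) * p x) q + \<sigma> * \<tau>\<^sup>2 * ip M (A_adj M \<alpha> p) (A_adj M \<alpha> q)"
  using ip_half_lincomb_left[of \<alpha> 1 "\<lambda>x. inverse (k x) * p x" "\<sigma> * \<tau>\<^sup>2" "A M \<alpha> (A_adj M \<alpha> p)" q]
  by (simp add: K_def ip_A_adj[OF A_adj_in_H])

lemma K_sym: "ip_half M \<alpha> (KK \<alpha> p) q = ip_half M \<alpha> (KK \<alpha> q) p"
proof -
  have "ip_half M \<alpha> (\<lambda>x. inverse (k x) * p x) q = ip_half M \<alpha> (\<lambda>x. inverse (k x) * q x) p"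
    by (simp add: ip_half_def mult.commute mult.left_commute)
  then show ?thesis
    by (simp add: ip_K ip_commute)
qed

lemma k_inverse_pos:
  "p \<in> H_half M \<alpha> \<Longrightarrow> p \<noteq> (\<lambda>_. 0) \<Longrightarrow> 0 < ip_half M \<alpha> (\<lambda>x. inverse (k x) * p x) p"
  using k_pos omega_half_subset_Omega by (intro ip_half_weighted_pos) auto

lemma K_pos: "p \<in> H_half M \<alpha> \<Longrightarrow> p \<noteq> (\<lambda>_. 0) \<Longrightarrow> 0 < ip_half M \<alpha> (KK \<alpha> p) p"
  unfolding ip_K using k_inverse_pos sigma_pos ip_self_nonneg by (simp add: add_pos_nonneg)

lemma K_inj: "inj_on (KK \<alpha>) (H_half M \<alpha>)"
proof (rule inj_onI)
  fix p q assume pq: "p \<in> H_half M \<alpha>" "q \<in> H_half M \<alpha>" "KK \<alpha> p = KK \<alpha> q"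
  define d where "d = (\<lambda>x. 1 * p x + (-1) * q x)"
  have "KK \<alpha> d = (\<lambda>_. 0)"
    unfolding d_def K_lincomb by (simp add: pq)
  then have "ip_half M \<alpha> (KK \<alpha> d) d = 0"
    by (simp add: ip_half_def)
  moreover have "d \<in> H_half M \<alpha>"
    unfolding d_def using pq by (intro H_half_lincomb)
  ultimately have "d = (\<lambda>_. 0)"
    using K_pos by force
  then show "p = q"
    by (simp add: d_def fun_eq_iff)
qed

text \<open>Injectivity suffices in finite dimension. Only now is the \<open>inv_into\<close> in
  \<open>C\<close> known to be a genuine inverse on \<open>H_half M \<alpha>\<close>.\<close>

lemma K_surj: "KK \<alpha> ` H_half M \<alpha> = H_half M \<alpha>"
proof -
  have V: "{f. \<forall>x. x \<notin> omega_half M \<alpha> \<longrightarrow> f x = 0} = H_half M \<alpha>"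
    by (simp add: H_half_def)
  have maps: "\<And>p. p \<in> H_half M \<alpha> \<Longrightarrow> KK \<alpha> p \<in> H_half M \<alpha>"
    by (rule K_in_H_half)
  have lin: "\<And>a b p q. KK \<alpha> (\<lambda>x. a * p x + b * q x) = (\<lambda>x. a * KK \<alpha> p x + b * KK \<alpha> q x)"
    by (rule K_lincomb)
  note surj = linear_inj_imp_surj_on_support[OF finite_omega_half[of \<alpha>], unfolded V, of "KK \<alpha>"]
  show ?thesis
    by (rule surj; (rule maps lin K_inj)?; assumption?)
qed

lemma P_in_H_half: "P \<alpha> y \<in> H_half M \<alpha>"
  by (rule inv_into_into) (simp add: K_surj A_in_H_half)

lemma K_P: "KK \<alpha> (P \<alpha> y) = A M \<alpha> y"
  by (rule f_inv_into_f[where A = "H_half M \<alpha>"]) (simp add: K_surj A_in_H_half)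

lemma P_eqI: "p \<in> H_half M \<alpha> \<Longrightarrow> KK \<alpha> p = A M \<alpha> y \<Longrightarrow> P \<alpha> y = p"
  by (rule inv_into_f_eq[OF K_inj])

lemma P_lincomb: "P \<alpha> (\<lambda>x. a * y x + b * w x) = (\<lambda>x. a * P \<alpha> y x + b * P \<alpha> w x)"
  by (rule P_eqI) (auto intro: H_half_lincomb P_in_H_half simp: K_lincomb K_P A_lincomb)

section \<open>Symmetry and definiteness of \<open>C\<close>\<close>

lemma C_eq: "CC y = (\<lambda>x. A_adj M 1 (P 1 y) x + A_adj M 2 (P 2 y) x)"
  by (simp add: C_def)

lemma C_in_H: "CC y \<in> H M"
  using H_lincomb[OF A_adj_in_H A_adj_in_H, of 1 _ _ 1] by (simp add: C_eq)

lemma C_lincomb: "CC (\<lambda>x. a * y x + b * w x) = (\<lambda>x. a * CC y x + b * CC w x)"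
  unfolding C_eq P_lincomb A_adj_lincomb by (simp add: algebra_simps)

text \<open>Replacing \<open>A M \<alpha> w\<close> by \<open>KK \<alpha> (P \<alpha> w)\<close>
  pulls the form of \<open>C\<close> back to that of \<open>K\<close>, from which it inherits
  symmetry and positivity.\<close>

lemma ip_A_adj_P: "w \<in> H M \<Longrightarrow> ip M (A_adj M \<alpha> (P \<alpha> y)) w = ip_half M \<alpha> (KK \<alpha> (P \<alpha> w)) (P \<alpha> y)"
  by (subst ip_commute) (simp add: ip_A_adj K_P)

lemma ip_C: "ip M (CC y) w
    = ip M (A_adj M 1 (P 1 y)) w + ip M (A_adj M 2 (P 2 y)) w"
  using ip_lincomb_left[of 1 "A_adj M 1 (P 1 y)" 1 "A_adj M 2 (P 2 y)" w] by (simp add: C_eq)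

lemma C_sym: "y \<in> H M \<Longrightarrow> w \<in> H M \<Longrightarrow> ip M (CC y) w = ip M (CC w) y"
  by (simp add: ip_C ip_A_adj_P K_sym[of _ "P _ w"])

text \<open>Both directions contribute nonnegatively. The first contributes strictly, since
  \<open>P 1 y = 0\<close> would force \<open>A M 1 y = 0\<close> and hence
  \<open>y = 0\<close>.\<close>

lemma C_pos:
  assumes "y \<in> H M" "y \<noteq> (\<lambda>_. 0)"
  shows "0 < ip M (CC y) y"
proof -
  have nonneg: "0 \<le> ip_half M \<alpha> (KK \<alpha> (P \<alpha> y)) (P \<alpha> y)" for \<alpha>
  proof (cases "P \<alpha> y = (\<lambda>_. 0)")
    case True
    then show ?thesis by (simp only: ip_half_def) simp
  next
    case False
    then show ?thesis using K_pos[OF P_in_H_half] by (simp add: less_imp_le)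
  qed
  have "P 1 y \<noteq> (\<lambda>_. 0)"
  proof
    assume "P 1 y = (\<lambda>_. 0)"
    then have "A M 1 y = KK 1 (\<lambda>_. 0)"
      using K_P[of 1 y] by simp
    also have "\<dots> = (\<lambda>_. 0)"
      using K_lincomb[of 1 0 "\<lambda>_. 0" 0 "\<lambda>_. 0"] by simp
    finally show False
      using A_eq_0_imp assms by blast
  qed
  then show ?thesis
    using assms nonneg[of 2] K_pos[OF P_in_H_half, of 1 y] by (simp add: ip_C ip_A_adj_P)
qed

text \<open>With \<open>p = K\<^sup>-\<^sup>1Ay\<close>, \<open>a = A\<^sup>*p\<close> and \<open>m = \<sigma>\<tau>\<^sup>2\<close> the number \<open>s = (a, y)\<close> equals
  \<open>(k\<^sup>-\<^sup>1p, p) + m(a, a)\<close>; expanding \<open>(ma - y, ma - y) \<ge> 0\<close> gives \<open>m s \<le> (y, y)\<close>.\<close>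

lemma A_adj_P_bound:
  assumes "y \<in> H M" "y \<noteq> (\<lambda>_. 0)"
  shows "\<sigma> * \<tau>\<^sup>2 * ip M (A_adj M \<alpha> (P \<alpha> y)) y < ip M y y"
proof -
  define p where "p = P \<alpha> y"
  define a where "a = A_adj M \<alpha> p"
  define m where "m = \<sigma> * \<tau>\<^sup>2"
  have m: "m > 0"
    using sigma_pos tau by (simp add: m_def)
  have p: "p \<in> H_half M \<alpha>"
    by (simp add: p_def P_in_H_half)
  have s: "ip M a y = ip_half M \<alpha> (\<lambda>x. inverse (k x) * p x) p + m * ip M a a"
    using ip_A_adj_P[OF assms(1), of \<alpha> y] by (simp add: ip_K a_def p_def m_def)
  show ?thesis
  \<comment> \<open>Strictness has two sources: if \<open>p\<close> vanishes, it is the positivity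
    of \<open>(y, y)\<close>; otherwise it is the positivity of
    \<open>(k\<^sup>-\<^sup>1p, p)\<close>.\<close>
  proof (cases "p = (\<lambda>_. 0)")
    case True
    have "a = (\<lambda>_. 0)"
      using A_adj_lincomb[of \<alpha> 0 p 0 p] True by (simp add: a_def)
    then have "ip M a y = 0"
      by (simp add: ip_def)
    then show ?thesis
      using ip_weighted_pos[of "\<lambda>_. 1" y] assms by (simp add: a_def p_def)
  next
    case False
    have "0 \<le> ip M (\<lambda>x. m * a x + (-1) * y x) (\<lambda>x. m * a x + (-1) * y x)"
      by (rule ip_self_nonneg)
    also have "\<dots> = m * (m * ip M a a) - 2 * (m * ip M a y) + ip M y y"
      unfolding ip_lincomb_left ip_lincomb_right by (simp add: ip_commute[of y a] algebra_simps)
    finally have "2 * (m * ip M a y) \<le> m * (m * ip M a a) + ip M y y"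
      by simp
    moreover have "m * (m * ip M a a) < m * ip M a y"
      using k_inverse_pos[OF p False] m by (simp add: s)
    ultimately have "m * ip M a y < ip M y y"
      by linarith
    then show ?thesis
      by (simp add: m_def a_def p_def)
  qed
qed

lemma ip_R: "ip M (RR y) w = \<nu> * ip M (\<lambda>x. c x * y x) w - \<tau>\<^sup>2 / 4 * ip M (CC y) w"
  using ip_lincomb_left[of \<nu> "\<lambda>x. c x * y x" "- (\<tau>\<^sup>2 / 4)" "CC y" w]
  by (simp add: R_def mult.assoc)

text \<open>The condition on \<sigma> enters here, as \<open>2 \<le> 4\<nu>c0\<sigma>\<close>.
  Dividing by 4\<sigma> bounds \<open>\<tau>\<^sup>2/4 (Cy, y)\<close> by
  \<open>\<nu>c0(y, y)\<close>, and then \<open>c \<ge> c0\<close> finishes. The factor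
  \<open>\<tau>\<^sup>2\<close> is the same in \<open>K\<close> and in \<open>R\<close>, so no bound
  on \<tau> or on the mesh steps arises.\<close>

lemma R_pos:
  assumes "y \<in> H M" "y \<noteq> (\<lambda>_. 0)"
  shows "0 < ip M (RR y) y"
proof -
  have "\<sigma> * \<tau>\<^sup>2 * ip M (CC y) y < 2 * ip M y y"
    using A_adj_P_bound[OF assms, of 1] A_adj_P_bound[OF assms, of 2]
    by (simp add: ip_C distrib_left)
  also have "2 * ip M y y \<le> 4 * (\<nu> * c0 * \<sigma>) * ip M y y"
    using sigma ip_self_nonneg[of y] by (intro mult_right_mono) linarith+
  finally have "\<sigma> * (\<tau>\<^sup>2 * ip M (CC y) y) < \<sigma> * (4 * (\<nu> * (c0 * ip M y y)))"
    by (simp add: mult_ac)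
  then have "\<tau>\<^sup>2 / 4 * ip M (CC y) y < \<nu> * (c0 * ip M y y)"
    using sigma_pos by simp
  also have "c0 * ip M y y \<le> ip M (\<lambda>x. c x * y x) y"
    unfolding ip_def sum_distrib_left
  proof (rule sum_mono)
    fix x assume "x \<in> omega M"
    then have "c0 \<le> c x"
      using c_ge omega_subset_Omega by blast
    then have "c0 * (y x * y x * h1 M * h2 M) \<le> c x * (y x * y x * h1 M * h2 M)"
      using h1_pos h2_pos by (intro mult_right_mono) simp_all
    then show "c0 * (y x * y x * h1 M * h2 M) \<le> c x * y x * y x * h1 M * h2 M"
      by (simp add: mult.assoc)
  qed
  finally show ?thesis
    using nu by (simp add: ip_R)
qed

lemma R_pos_def: "pos_def_operator M RR"
  unfolding pos_def_operator_def
proof (intro conjI ballI impI)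
  show "RR \<in> H M \<rightarrow> H M"
    using C_in_H by (auto simp: H_eq R_def)
  show "ip M (RR y) w = ip M y (RR w)" if "y \<in> H M" "w \<in> H M" for y w
  proof -
    have "ip M (\<lambda>x. c x * y x) w = ip M (\<lambda>x. c x * w x) y"
      by (simp add: ip_def mult.commute mult.left_commute)
    then show ?thesis
      using C_sym[OF that] by (simp add: ip_commute[of y] ip_R)
  qed
qed (rule R_pos)

section \<open>The energy form\<close>

text \<open>The terms \<open>(Cv, v)\<close> and \<open>(Cw, w)\<close> coming from \<open>R\<close> and from the mean value cancel.\<close>

lemma S_form_eq:
  assumes "v \<in> H M" "w \<in> H M"
  shows "SS v w = \<nu> / \<tau>\<^sup>2 * ip M (\<lambda>x. c x * (v x - w x)) (\<lambda>x. v x - w x) + ip M (CC v) w"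
proof -
  define d where "d = (\<lambda>x. (1 / \<tau>) * v x + (- 1 / \<tau>) * w x)"
  define m where "m = (\<lambda>x. (1 / 2) * v x + (1 / 2) * w x)"
  have d: "(\<lambda>x. (v x - w x) / \<tau>) = d" and m: "(\<lambda>x. (v x + w x) / 2) = m"
    by (simp_all add: d_def m_def diff_divide_distrib add_divide_distrib)
  have vw: "ip M (CC w) v = ip M (CC v) w"
    using C_sym assms by blast
  have Cd: "\<tau>\<^sup>2 * ip M (CC d) d = ip M (CC v) v - 2 * ip M (CC v) w + ip M (CC w) w"
    unfolding d_def C_lincomb ip_lincomb_left ip_lincomb_right vw
    using tau by (simp add: field_simps power2_eq_square)
  have Cm: "4 * ip M (CC m) m = ip M (CC v) v + 2 * ip M (CC v) w + ip M (CC w) w"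
    unfolding m_def C_lincomb ip_lincomb_left ip_lincomb_right vw
    by (simp add: field_simps)
  have cd: "ip M (\<lambda>x. c x * d x) d = ip M (\<lambda>x. c x * (v x - w x)) (\<lambda>x. v x - w x) / \<tau>\<^sup>2"
    unfolding d[symmetric] ip_def by (simp add: sum_divide_distrib power2_eq_square)
  show ?thesis
    unfolding S_form_def d m ip_R cd using Cd Cm by (simp add: field_simps)
qed

text \<open>The polarization of the expression in \<open>S_form_eq\<close>. The product
  \<open>(Cv, w)\<close> mixes the two components of one pair, hence the average over both ways of
  pairing them.\<close>

definition S_bilinear :: "gridfun \<times> gridfun \<Rightarrow> gridfun \<times> gridfun \<Rightarrow> real" where
  "S_bilinear z z' =
     \<nu> / \<tau>\<^sup>2 * ip M (\<lambda>x. c x * (fst z x - snd z x)) (\<lambda>x. fst z' x - snd z' x)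
     + (ip M (CC (fst z)) (snd z') + ip M (CC (fst z')) (snd z)) / 2"

lemma S_bilinear_commute: "S_bilinear z z' = S_bilinear z' z"
proof -
  have "ip M (\<lambda>x. c x * f x) g = ip M (\<lambda>x. c x * g x) f" for f g
    by (simp add: ip_def mult.commute mult.left_commute)
  then show ?thesis
    by (simp add: S_bilinear_def)
qed

lemma S_bilinear_lincomb:
  "S_bilinear (\<lambda>x. a * v x + b * v' x, \<lambda>x. a * w x + b * w' x) z
     = a * S_bilinear (v, w) z + b * S_bilinear (v', w') z"
proof -
  have "(\<lambda>x. c x * (a * v x + b * v' x - (a * w x + b * w' x)))
      = (\<lambda>x. a * (c x * (v x - w x)) + b * (c x * (v' x - w' x)))"
    by (simp add: algebra_simps)
  then show ?thesis
    unfolding S_bilinear_def fst_conv snd_conv C_lincomb ip_lincomb_right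
    by (simp only: ip_lincomb_left) (simp add: add_divide_distrib distrib_left mult.left_commute)
qed

lemma S_form_bilinear: "v \<in> H M \<Longrightarrow> w \<in> H M \<Longrightarrow> SS v w = S_bilinear (v, w) (v, w)"
  by (simp add: S_form_eq S_bilinear_def)

lemma S_form_pos:
  assumes "v \<in> H M" "w \<in> H M" "(v, w) \<noteq> (\<lambda>_. 0, \<lambda>_. 0)"
  shows "0 < SS v w"
proof -
  define d where "d = (\<lambda>x. (v x - w x) / \<tau>)"
  define m where "m = (\<lambda>x. (v x + w x) / 2)"
  have dm: "d \<in> H M" "m \<in> H M"
    using assms by (auto simp: d_def m_def H_eq)
  have R: "0 \<le> ip M (RR d) d"
    using R_pos[OF dm(1)] by (cases "d = (\<lambda>_. 0)") (auto simp: ip_def less_imp_le)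
  have C: "0 \<le> ip M (CC m) m"
    using C_pos[OF dm(2)] by (cases "m = (\<lambda>_. 0)") (auto simp: ip_def less_imp_le)
  \<comment> \<open>Half sum and scaled difference together determine \<open>v\<close> and
    \<open>w\<close>, so at least one of the two terms is strictly positive.\<close>
  have "d \<noteq> (\<lambda>_. 0) \<or> m \<noteq> (\<lambda>_. 0)"
  proof (rule ccontr)
    assume "\<not> ?thesis"
    then have "(v x - w x) / \<tau> = 0" "(v x + w x) / 2 = 0" for x
      unfolding d_def m_def by meson+
    then have "v x = 0 \<and> w x = 0" for x
      using tau by (smt (verit) divide_eq_0_iff)
    then show False
      using assms(3) by (auto simp: fun_eq_iff)
  qed
  then have "0 < ip M (RR d) d + ip M (CC m) m"
    using R_pos[OF dm(1)] C_pos[OF dm(2)] R C by fastforce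
  then show ?thesis
    by (simp add: S_form_def d_def m_def)
qed

lemma S_form_nonneg: "v \<in> H M \<Longrightarrow> w \<in> H M \<Longrightarrow> 0 \<le> SS v w"
  and S_form_eq_0_iff: "v \<in> H M \<Longrightarrow> w \<in> H M \<Longrightarrow> SS v w = 0 \<longleftrightarrow> v = (\<lambda>_. 0) \<and> w = (\<lambda>_. 0)"
proof -
  have "SS (\<lambda>_. 0) (\<lambda>_. 0) = 0"
    by (simp add: S_form_def ip_def)
  then show "v \<in> H M \<Longrightarrow> w \<in> H M \<Longrightarrow> 0 \<le> SS v w"
    "v \<in> H M \<Longrightarrow> w \<in> H M \<Longrightarrow> SS v w = 0 \<longleftrightarrow> v = (\<lambda>_. 0) \<and> w = (\<lambda>_. 0)"
    using S_form_pos[of v w] by fastforce+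
qed

lemma S_form_quadratic: "pos_def_quadratic_form_pairs (H M) SS"
  unfolding pos_def_quadratic_form_pairs_def
proof (intro conjI)
  show "\<forall>v\<in>H M. \<forall>w\<in>H M. (v, w) \<noteq> (\<lambda>_. 0, \<lambda>_. 0) \<longrightarrow> 0 < SS v w"
    using S_form_pos by blast
qed (use S_bilinear_commute S_bilinear_lincomb S_form_bilinear in \<open>intro exI[of _ S_bilinear]; simp\<close>)

section \<open>The norm on pairs\<close>

lemma S_form_lincomb:
  assumes "v \<in> H M" "w \<in> H M" "v' \<in> H M" "w' \<in> H M"
  shows "SS (\<lambda>x. a * v x + b * v' x) (\<lambda>x. a * w x + b * w' x)
    = a\<^sup>2 * SS v w + 2 * a * b * S_bilinear (v, w) (v', w') + b\<^sup>2 * SS v' w'"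
proof -
  let ?z = "(\<lambda>x. a * v x + b * v' x, \<lambda>x. a * w x + b * w' x)"
  have "SS (fst ?z) (snd ?z) = S_bilinear ?z ?z"
    using assms by (simp add: S_form_bilinear H_lincomb)
  also have "\<dots> = a * S_bilinear ?z (v, w) + b * S_bilinear ?z (v', w')"
    by (subst S_bilinear_lincomb) (simp add: S_bilinear_commute)
  also have "\<dots> = a\<^sup>2 * SS v w + 2 * a * b * S_bilinear (v, w) (v', w') + b\<^sup>2 * SS v' w'"
    unfolding S_bilinear_lincomb
    using assms by (simp add: S_form_bilinear S_bilinear_commute[of "(v', w')" "(v, w)"]
        power2_eq_square algebra_simps)
  finally show ?thesis
    by simp
qed

lemma S_Cauchy_Schwarz:
  assumes H: "v \<in> H M" "w \<in> H M" "v' \<in> H M" "w' \<in> H M"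
  shows "S_bilinear (v, w) (v', w') \<le> sqrt (SS v w) * sqrt (SS v' w')"
proof -
  let ?a = "SS v w" and ?b = "S_bilinear (v, w) (v', w')" and ?e = "SS v' w'"
  have "?b\<^sup>2 \<le> ?a * ?e"
  \<comment> \<open>If \<open>?a\<close> vanishes, definiteness makes the first pair zero. Otherwise
    the form is evaluated at the combination with coefficients \<open>- ?b\<close> and
    \<open>?a\<close>, where it equals \<open>?a\<close> times the wanted difference.\<close>
  proof (cases "?a = 0")
    case True
    then have "v = (\<lambda>_. 0)" "w = (\<lambda>_. 0)"
      using S_form_eq_0_iff H by blast+
    then have "?b = 0"
      using S_bilinear_lincomb[of 0 v 0 v w w "(v', w')"] by simp
    then show ?thesis
      using True by simp
  next
    case False
    then have a: "?a > 0"
      using S_form_nonneg[of v w] H by simp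
    have "0 \<le> SS (\<lambda>x. (- ?b) * v x + ?a * v' x) (\<lambda>x. (- ?b) * w x + ?a * w' x)"
      using H by (intro S_form_nonneg H_lincomb)
    also have "\<dots> = ?a * (?a * ?e - ?b\<^sup>2)"
      by (simp only: S_form_lincomb[OF H]) (simp add: power2_eq_square algebra_simps)
    finally show ?thesis
      using a by (simp add: zero_le_mult_iff)
  qed
  then have "\<bar>?b\<bar> \<le> sqrt (?a * ?e)"
    using real_le_rsqrt[of "\<bar>?b\<bar>"] by simp
  then show ?thesis
    by (simp add: real_sqrt_mult)
qed

lemma S_form_norm: "norm_on_pairs (H M) (\<lambda>v w. sqrt (SS v w))"
  unfolding norm_on_pairs_def
proof (intro conjI ballI allI)
  fix v w assume H: "v \<in> H M" "w \<in> H M"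
  show "0 \<le> sqrt (SS v w)"
    using S_form_nonneg H by simp
  show "sqrt (SS v w) = 0 \<longleftrightarrow> v = (\<lambda>_. 0) \<and> w = (\<lambda>_. 0)"
    using S_form_eq_0_iff H by simp
  show "sqrt (SS (\<lambda>x. a * v x) (\<lambda>x. a * w x)) = \<bar>a\<bar> * sqrt (SS v w)" for a
    \<comment> \<open>With \<open>b = 0\<close> the second pair is a mere placeholder.\<close>
    using S_form_lincomb[of v w v w a 0] H by (simp add: real_sqrt_mult)
  fix v' w' assume H': "v' \<in> H M" "w' \<in> H M"
  have "SS (\<lambda>x. v x + v' x) (\<lambda>x. w x + w' x) = SS v w + 2 * S_bilinear (v, w) (v', w') + SS v' w'"
    using S_form_lincomb[of v w v' w' 1 1] H H' by simp
  also have "\<dots> \<le> (sqrt (SS v w) + sqrt (SS v' w'))\<^sup>2"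
    using S_Cauchy_Schwarz[OF H H'] S_form_nonneg H H' by (simp add: power2_sum)
  finally show "sqrt (SS (\<lambda>x. v x + v' x) (\<lambda>x. w x + w' x)) \<le> sqrt (SS v w) + sqrt (SS v' w')"
    using S_form_nonneg H H' by (intro real_le_lsqrt) auto
qed

section \<open>The energy inequality and the elimination of the fluxes\<close>

text \<open>Here \<open>v\<close>, \<open>w\<close>, \<open>z\<close> stand for three consecutive
  time levels, newest first, and \<open>g\<close> for the right-hand side. Once symmetry has moved
  \<open>C\<close> onto the middle level, the three-level equation gives \<open>CC w x\<close> at
  each node, so the sums compare termwise.\<close>

lemma energy_step:
  assumes H: "v \<in> H M" "w \<in> H M" "z \<in> H M"
    and eq: "\<And>x. x \<in> omega M \<Longrightarrow>
      c x * ((v x - z x) / (2 * \<tau>) + \<nu> * (v x - 2 * w x + z x) / \<tau>\<^sup>2) + CC w x = g x"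
  shows "SS v w \<le> SS w z + \<tau> / 2 * ip M (\<lambda>x. inverse (c x) * g x) g"
proof -
  have "ip M (CC w) (\<lambda>x. 1 * v x + (-1) * z x) = ip M (CC v) w - ip M (CC w) z"
    unfolding ip_lincomb_right using C_sym[OF H(1,2)] by simp
  then have Cvz: "ip M (CC v) w = ip M (CC w) z + ip M (CC w) (\<lambda>x. v x - z x)"
    by simp
  have "\<nu> / \<tau>\<^sup>2 * ip M (\<lambda>x. c x * (v x - w x)) (\<lambda>x. v x - w x) + ip M (CC w) (\<lambda>x. v x - z x)
      \<le> \<nu> / \<tau>\<^sup>2 * ip M (\<lambda>x. c x * (w x - z x)) (\<lambda>x. w x - z x)
        + \<tau> / 2 * ip M (\<lambda>x. inverse (c x) * g x) g"
    unfolding ip_def sum_distrib_left sum.distrib[symmetric]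
  proof (rule sum_mono)
    fix x assume x: "x \<in> omega M"
    have c: "c x > 0"
      by (rule c_pos[OF x])
    define r where "r = v x - z x"
    define h where "h = h1 M * h2 M"
    have h: "0 \<le> h"
      using h1_pos h2_pos by (simp add: h_def)
    have Cw: "CC w x = g x - c x * (r / (2 * \<tau>) + \<nu> * (v x - 2 * w x + z x) / \<tau>\<^sup>2)"
      using eq[OF x] by (simp add: r_def)
    \<comment> \<open>Young's inequality with the weight for which the damping term is used up
      entirely: the gap is a perfect square over \<open>2 * \<tau> * c x\<close>.\<close>
    have "g x * r - c x * r\<^sup>2 / (2 * \<tau>) \<le> \<tau> / 2 * (inverse (c x) * (g x)\<^sup>2)"
    proof -
      have "\<tau> / 2 * (inverse (c x) * (g x)\<^sup>2) - (g x * r - c x * r\<^sup>2 / (2 * \<tau>))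
          = (\<tau> * g x - c x * r)\<^sup>2 / (2 * \<tau> * c x)"
        using c tau by (simp add: field_simps power2_eq_square)
      also have "\<dots> \<ge> 0"
        using c tau by simp
      finally show ?thesis
        by simp
    qed
    \<comment> \<open>Telescoping: \<open>v - 2w + z\<close> is the difference and
      \<open>v - z\<close> the sum of \<open>v - w\<close> and \<open>w - z\<close>, so their
      product is a difference of squares.\<close>
    moreover have "\<nu> / \<tau>\<^sup>2 * (c x * (v x - w x)\<^sup>2) + CC w x * r
        = \<nu> / \<tau>\<^sup>2 * (c x * (w x - z x)\<^sup>2) + (g x * r - c x * r\<^sup>2 / (2 * \<tau>))"
      unfolding Cw r_def using tau by (simp add: field_simps power2_eq_square)
    ultimately have "\<nu> / \<tau>\<^sup>2 * (c x * (v x - w x)\<^sup>2) + CC w x * r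
        \<le> \<nu> / \<tau>\<^sup>2 * (c x * (w x - z x)\<^sup>2) + \<tau> / 2 * (inverse (c x) * (g x)\<^sup>2)"
      by linarith
    from mult_right_mono[OF this h]
    show "\<nu> / \<tau>\<^sup>2 * (c x * (v x - w x) * (v x - w x) * h1 M * h2 M)
        + CC w x * (v x - z x) * h1 M * h2 M
      \<le> \<nu> / \<tau>\<^sup>2 * (c x * (w x - z x) * (w x - z x) * h1 M * h2 M)
        + \<tau> / 2 * (inverse (c x) * g x * g x * h1 M * h2 M)"
      by (simp add: r_def h_def power2_eq_square distrib_right mult.assoc)
  qed
  then show ?thesis
    using H by (simp add: S_form_eq Cvz)
qed

text \<open>Eliminating the fluxes: the combination of \<open>q\<^sub>\<alpha>\<close> in the first equation of the scheme is
  \<open>-K\<^sup>-\<^sup>1A\<^sub>\<alpha>u\<close>, and the same combination of the second equation at two time levels produces \<open>C u\<close>.\<close>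

lemma flux_elimination:
  assumes q: "\<And>\<alpha>. \<alpha> \<in> {1, 2} \<Longrightarrow> q \<alpha> \<in> H_half M \<alpha>" "\<And>\<alpha>. \<alpha> \<in> {1, 2} \<Longrightarrow> q' \<alpha> \<in> H_half M \<alpha>"
    and flux: "\<And>\<alpha> x. \<alpha> \<in> {1, 2} \<Longrightarrow> x \<in> omega_half M \<alpha> \<Longrightarrow>
      KK \<alpha> (\<lambda>x. (q' \<alpha> x + q \<alpha> x) / 2) x + \<nu> * KK \<alpha> (\<lambda>x. (q' \<alpha> x - q \<alpha> x) / \<tau>) x + A M \<alpha> y x = 0"
  shows "CC y x = - (\<Sum>\<alpha>\<in>{1, 2}. (A_adj M \<alpha> (q' \<alpha>) x + A_adj M \<alpha> (q \<alpha>) x) / 2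
      + \<nu> * ((A_adj M \<alpha> (q' \<alpha>) x - A_adj M \<alpha> (q \<alpha>) x) / \<tau>))"
proof -
  \<comment> \<open>The coefficients of the newer and older flux when the mean value plus \<nu>
    times the difference quotient is collected.\<close>
  define s t where "s = 1 / 2 + \<nu> / \<tau>" and "t = 1 / 2 - \<nu> / \<tau>"
  have P: "P \<alpha> y = (\<lambda>x. (- s) * q' \<alpha> x + (- t) * q \<alpha> x)" if \<alpha>: "\<alpha> \<in> {1, 2}" for \<alpha>
  proof (rule P_eqI)
    let ?p = "\<lambda>x. (- s) * q' \<alpha> x + (- t) * q \<alpha> x"
    show p: "?p \<in> H_half M \<alpha>"
      using q \<alpha> by (intro H_half_lincomb) auto
    show "KK \<alpha> ?p = A M \<alpha> y"
    proof
      fix x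
      have 1: "(\<lambda>x. (q' \<alpha> x + q \<alpha> x) / 2) = (\<lambda>x. (1/2) * q' \<alpha> x + (1/2) * q \<alpha> x)"
        "(\<lambda>x. (q' \<alpha> x - q \<alpha> x) / \<tau>) = (\<lambda>x. (1/\<tau>) * q' \<alpha> x + (- 1/\<tau>) * q \<alpha> x)"
        by (simp_all add: add_divide_distrib diff_divide_distrib)
      show "KK \<alpha> ?p x = A M \<alpha> y x"
      \<comment> \<open>The flux equation is given on the staggered grid only; elsewhere both sides
        are zero by the extension convention.\<close>
      proof (cases "x \<in> omega_half M \<alpha>")
        case True
        then show ?thesis
          using flux[OF \<alpha> True] unfolding 1 K_lincomb by (simp add: s_def t_def algebra_simps)
      next
        case False
        then show ?thesis
          using K_in_H_half[OF p] A_in_H_half[of \<alpha> y] unfolding H_half_def by (metis (mono_tags, lifting) mem_Collect_eq)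
      qed
    qed
  qed
  have "A_adj M \<alpha> (P \<alpha> y) x = - ((A_adj M \<alpha> (q' \<alpha>) x + A_adj M \<alpha> (q \<alpha>) x) / 2
      + \<nu> * ((A_adj M \<alpha> (q' \<alpha>) x - A_adj M \<alpha> (q \<alpha>) x) / \<tau>))" if "\<alpha> \<in> {1, 2}" for \<alpha>
    unfolding P[OF that] A_adj_lincomb
    by (simp add: s_def t_def add_divide_distrib diff_divide_distrib algebra_simps)
  then show ?thesis
    by (simp add: C_eq)
qed

end

theorem theorem7p3:
  fixes M :: mesh
    and c0 k0 k1 \<nu> \<sigma> \<tau> T :: real
    and N :: nat
    and c k :: "point \<Rightarrow> real"
    and u :: "nat \<Rightarrow> gridfun"           (* u n is the value at t_n *)
    and q :: "nat \<Rightarrow> nat \<Rightarrow> gridfun"    (* q \<alpha> n is the value of q_\<alpha> at t_n + \<tau>/2 *)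
    and f :: "nat \<Rightarrow> gridfun"           (* f n is the value at t_n + \<tau>/2 *)
    and S :: "nat \<Rightarrow> real"
  assumes "l1 M > 0" "l2 M > 0" "N1 M \<ge> 2" "N2 M \<ge> 2"
    and "\<nu> > 0" "\<tau> > 0" "N \<ge> 2" "real N * \<tau> = T"
    and "c0 > 0" "\<forall>x \<in> Omega M. c x \<ge> c0"
    and "k0 > 0" "\<forall>x \<in> Omega M. k0 \<le> k x \<and> k x \<le> k1"
    and "\<nu> * c0 * \<sigma> \<ge> 0.5"
    and "\<forall>n\<le>N. u n \<in> H M"
    and "\<forall>\<alpha>\<in>{1,2}. \<forall>n<N. q \<alpha> n \<in> H_half M \<alpha>"
    and "\<forall>n<N. f n \<in> H M"
    and "\<forall>\<alpha>\<in>{1,2}. \<forall>n\<in>{1..N - 1}. \<forall>x \<in> omega_half M \<alpha>.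
           K M k \<sigma> \<tau> \<alpha> (\<lambda>x. (q \<alpha> n x + q \<alpha> (n - 1) x) / 2) x
           + \<nu> * K M k \<sigma> \<tau> \<alpha> (\<lambda>x. (q \<alpha> n x - q \<alpha> (n - 1) x) / \<tau>) x
           + A M \<alpha> (u n) x = 0"
    and "\<forall>n\<in>{0..N - 1}. \<forall>x \<in> omega M.
           c x * ((u (n + 1) x - u n x) / \<tau>) - (\<Sum>\<alpha>\<in>{1,2}. A_adj M \<alpha> (q \<alpha> n) x) = f n x"
    and S_eq: "\<forall>n\<in>{1..N}. S n = S_form M c k \<nu> \<sigma> \<tau> (u n) (u (n - 1))"
  shows "pos_def_operator M (R M c k \<nu> \<sigma> \<tau>)
    \<and> pos_def_quadratic_form_pairs (H M) (S_form M c k \<nu> \<sigma> \<tau>)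
    \<and> (\<exists>p. norm_on_pairs (H M) p \<and>
           (\<forall>v \<in> H M. \<forall>w \<in> H M. S_form M c k \<nu> \<sigma> \<tau> v w = (p v w)^2))
    \<and> (\<forall>n\<in>{1..N - 1}.
         S (n + 1) \<le> S n + \<tau> / 2 * ip M (\<lambda>x. inverse (c x) * phi \<nu> \<tau> f n x) (phi \<nu> \<tau> f n))"
proof (intro conjI)
  interpret additive_scheme M c k \<nu> \<sigma> \<tau> c0
  proof
    show "k x > 0" if "x \<in> Omega M" for x
      using assms(11,12) that by fastforce
  qed (use assms in auto)
  show "pos_def_operator M (R M c k \<nu> \<sigma> \<tau>)"
    by (rule R_pos_def)
  show "pos_def_quadratic_form_pairs (H M) (S_form M c k \<nu> \<sigma> \<tau>)"
    by (rule S_form_quadratic)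
  show "\<exists>p. norm_on_pairs (H M) p \<and>
      (\<forall>v\<in>H M. \<forall>w\<in>H M. S_form M c k \<nu> \<sigma> \<tau> v w = (p v w)\<^sup>2)"
    using S_form_norm S_form_nonneg by (intro exI[of _ "\<lambda>v w. sqrt (SS v w)"]) simp
  show "\<forall>n\<in>{1..N - 1}.
      S (n + 1) \<le> S n + \<tau> / 2 * ip M (\<lambda>x. inverse (c x) * phi \<nu> \<tau> f n x) (phi \<nu> \<tau> f n)"
  proof
    fix n assume n: "n \<in> {1..N - 1}"
    have "SS (u (n + 1)) (u n) \<le> SS (u n) (u (n - 1))
        + \<tau> / 2 * ip M (\<lambda>x. inverse (c x) * phi \<nu> \<tau> f n x) (phi \<nu> \<tau> f n)"
    proof (rule energy_step)
      show "u (n + 1) \<in> H M" "u n \<in> H M" "u (n - 1) \<in> H M"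
        using n assms(14) by auto
      fix x assume x: "x \<in> omega M"
      define a b where "a = (\<Sum>\<alpha>\<in>{1, 2}. A_adj M \<alpha> (q \<alpha> n) x)"
        and "b = (\<Sum>\<alpha>\<in>{1, 2}. A_adj M \<alpha> (q \<alpha> (n - 1)) x)"
      have fn: "f n x = c x * ((u (n + 1) x - u n x) / \<tau>) - a"
        using assms(18) n x unfolding a_def by fastforce
      \<comment> \<open>The balance equation starts at level 0, so it is available one level back
        even for \<open>n = 1\<close>.\<close>
      have "n - 1 \<in> {0..N - 1}" "n - 1 + 1 = n"
        using n by auto
      then have fn': "f (n - 1) x = c x * ((u n x - u (n - 1) x) / \<tau>) - b"
        using assms(18) x unfolding b_def by metis
      have "CC (u n) x = - (\<Sum>\<alpha>\<in>{1, 2}. (A_adj M \<alpha> (q \<alpha> n) x + A_adj M \<alpha> (q \<alpha> (n - 1)) x) / 2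
          + \<nu> * ((A_adj M \<alpha> (q \<alpha> n) x - A_adj M \<alpha> (q \<alpha> (n - 1)) x) / \<tau>))"
        by (rule flux_elimination) (use assms(15,17) n in auto)
      also have "\<dots> = - ((a + b) / 2 + \<nu> * ((a - b) / \<tau>))"
        by (simp add: a_def b_def add_divide_distrib diff_divide_distrib algebra_simps)
      finally have Cu: "CC (u n) x = - ((a + b) / 2 + \<nu> * ((a - b) / \<tau>))" .
      \<comment> \<open>Averaging and differencing the balance equations puts \<open>a\<close> and
        \<open>b\<close> into \<open>phi\<close> exactly as they stand in \<open>CC (u n) x\<close>;
        what remains is the central and the second time difference of \<open>u\<close>.\<close>
      show "c x * ((u (n + 1) x - u (n - 1) x) / (2 * \<tau>)
          + \<nu> * (u (n + 1) x - 2 * u n x + u (n - 1) x) / \<tau>\<^sup>2) + CC (u n) x = phi \<nu> \<tau> f n x"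
        unfolding phi_def fn fn' Cu using tau by (simp add: field_simps power2_eq_square)
    qed
    then show "S (n + 1) \<le> S n
        + \<tau> / 2 * ip M (\<lambda>x. inverse (c x) * phi \<nu> \<tau> f n x) (phi \<nu> \<tau> f n)"
      using S_eq n by auto
  qed
qed

end
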